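(* A nonempty shift space $X$ over a finite alphabet admits a Gibbs state if and only if it is balanced.
   Context: $\mathcal{B}_n(X)$ is the set of words of length $n$ appearing in points of $X$, $\mathcal{B}(X)=\bigcup_n\mathcal{B}_n(X)$, and $h(X)=\lim_{n}\frac1n\log|\mathcal{B}_n(X)|$ with $\log$ to base $2$. For $\omega\in\mathcal{B}(X)$ and $r\in\mathbb{N}$, $\mathcal{B}_{\omega,r}(X)$ is the set of words $u$ of length $r$ with $\omega u\in\mathcal{B}(X)$. $X$ is balanced if there is $B>0$ such that $|\mathcal{B}_{\omega,r}(X)|/|\mathcal{B}_r(X)|\ge B$ for all $\omega\in\mathcal{B}(X)$, $r\in\mathbb{N}$. For a word $\omega$, $[\omega]$ denotes the cylinder set of points of $X$ having $\omega$ at a fixed position. A Borel probability measure $\mu$ on $X$ is a Gibbs state if there exist $c_1,c_2>0$ such that for all $\omega\in\mathcal{B}(X)$ of length $r$, $c_1\le\mu([\omega])\,2^{r h(X)}\le c_2$. *)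

theory Defs
  imports "HOL-Probability.Probability"
begin

definition fullshift_topology :: "(int \<Rightarrow> 'a) topology" where
  "fullshift_topology = product_topology (\<lambda>_. discrete_topology UNIV) UNIV"

definition shift_map :: "(int \<Rightarrow> 'a) \<Rightarrow> (int \<Rightarrow> 'a)" where
  "shift_map x = (\<lambda>i. x (i + 1))"

definition shift_space :: "(int \<Rightarrow> 'a::finite) set \<Rightarrow> bool" where
  "shift_space X \<longleftrightarrow> closedin fullshift_topology X \<and> shift_map ` X = X"

definition words :: "(int \<Rightarrow> 'a) set \<Rightarrow> nat \<Rightarrow> 'a list set" where
  "words X n = {w. length w = n \<and> (\<exists>x\<in>X. \<exists>k::int. w = map (\<lambda>i. x (k + int i)) [0..<n])}"

definition language :: "(int \<Rightarrow> 'a) set \<Rightarrow> 'a list set" where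
  "language X = (\<Union>n. words X n)"

definition entropy :: "(int \<Rightarrow> 'a) set \<Rightarrow> real" where
  "entropy X = lim (\<lambda>n. log 2 (real (card (words X n))) / real n)"

definition followers :: "(int \<Rightarrow> 'a) set \<Rightarrow> 'a list \<Rightarrow> nat \<Rightarrow> 'a list set" where
  "followers X \<omega> r = {u. length u = r \<and> \<omega> @ u \<in> language X}"

definition balanced :: "(int \<Rightarrow> 'a) set \<Rightarrow> bool" where
  "balanced X \<longleftrightarrow> (\<exists>B>0. \<forall>\<omega>\<in>language X. \<forall>r::nat.
      real (card (followers X \<omega> r)) / real (card (words X r)) \<ge> B)"

definition cylinder :: "(int \<Rightarrow> 'a) set \<Rightarrow> 'a list \<Rightarrow> (int \<Rightarrow> 'a) set" where
  "cylinder X \<omega> = {x\<in>X. \<forall>i<length \<omega>. x (int i) = \<omega> ! i}"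

definition borel_sets_of :: "(int \<Rightarrow> 'a) set \<Rightarrow> (int \<Rightarrow> 'a) set set" where
  "borel_sets_of X = sigma_sets X {U. openin (subtopology fullshift_topology X) U}"

definition borel_prob_measure_on :: "(int \<Rightarrow> 'a) set \<Rightarrow> (int \<Rightarrow> 'a) measure \<Rightarrow> bool" where
  "borel_prob_measure_on X \<mu> \<longleftrightarrow> prob_space \<mu> \<and> space \<mu> = X \<and> sets \<mu> = borel_sets_of X"

definition gibbs_state :: "(int \<Rightarrow> 'a) set \<Rightarrow> (int \<Rightarrow> 'a) measure \<Rightarrow> bool" where
  "gibbs_state X \<mu> \<longleftrightarrow> borel_prob_measure_on X \<mu> \<and>
     (\<exists>c1>0. \<exists>c2>0. \<forall>\<omega>\<in>language X.
        c1 \<le> measure \<mu> (cylinder X \<omega>) * 2 powr (real (length \<omega>) * entropy X) \<and>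
        measure \<mu> (cylinder X \<omega>) * 2 powr (real (length \<omega>) * entropy X) \<le> c2)"

end

theory Submission
  imports Defs
begin

text \<open>
  If \<open>\<mu>\<close> is a Gibbs state, the whole space is the disjoint union of the cylinders of length \<open>r\<close>,
  so the number of words of length \<open>r\<close> is at most \<open>2 powr (r h) / c1\<close>; decomposing \<open>[\<omega>]\<close> into the
  cylinders \<open>[\<omega> u]\<close> bounds the number of followers of \<open>\<omega>\<close> below by \<open>c1 / c2 * 2 powr (r h)\<close>.
  Conversely, balancedness makes the logarithm of the number of words of length \<open>n\<close> additive up to
  a bounded error, so it stays within bounded distance of \<open>n h\<close>. Spread unit mass uniformly
  over representatives of the words of length \<open>N\<close>: the mass of \<open>[\<omega>]\<close> is the number of followers
  of \<open>\<omega>\<close> divided by the number of words, which satisfies the Gibbs bounds uniformly in \<open>N\<close>.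
  By Tychonoff these set functions have a cluster point, which is finitely additive on all sets.
  On the clopen algebra of the compact space \<open>X\<close> it is a premeasure, and its Caratheodory extension
  is a Gibbs state.
\<close>

section \<open>Words, cylinders and followers\<close>

lemma shift_space_translate:
  assumes "shift_space X" "x \<in> X"
  shows "(\<lambda>i. x (i + k)) \<in> X"
proof -
  have S: "shift_map ` X = X" using assms(1) by (simp add: shift_space_def)
  show ?thesis
  proof (induction k rule: int_induct[where k = 0])
    case base
    then show ?case using assms by simp
  next
    case (step1 k)
    have "shift_map (\<lambda>i. x (i + k)) \<in> X" using step1 S by blast
    then show ?case by (simp add: shift_map_def add.commute add.left_commute)
  next
    case (step2 k)
    then obtain y where y: "y \<in> X" "shift_map y = (\<lambda>i. x (i + k))"
      using S by (metis imageE)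
    \<comment> \<open>The shift is injective on two-sided sequences, so the preimage found in
      \<open>X\<close> can only be the translate by \<open>k - 1\<close>.\<close>
    have "y = (\<lambda>i. x (i + (k - 1)))"
    proof
      fix i
      have "shift_map y (i - 1) = x (i - 1 + k)" by (simp add: y)
      then show "y i = x (i + (k - 1))" by (simp add: shift_map_def algebra_simps)
    qed
    then show ?case using y by simp
  qed
qed

text \<open>A word may occur at any position of a point, whereas \<open>cylinder\<close> reads from
  coordinate 0; translating by \<open>k\<close> moves the occurrence to the origin. From here on,
  belonging to the language is handled as nonemptiness of a cylinder.\<close>

lemma words_iff_cylinder:
  assumes "shift_space X"
  shows "w \<in> words X n \<longleftrightarrow> length w = n \<and> cylinder X w \<noteq> {}"
proof
  assume w: "w \<in> words X n"
  then obtain x k where x: "x \<in> X" "w = map (\<lambda>i. x (k + int i)) [0..<n]"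
    by (auto simp: words_def)
  then have "(\<lambda>i. x (i + k)) \<in> cylinder X w"
    using shift_space_translate[OF assms x(1), of k]
    by (simp add: cylinder_def add.commute[of k])
  then show "length w = n \<and> cylinder X w \<noteq> {}" using w by (auto simp: words_def)
next
  assume "length w = n \<and> cylinder X w \<noteq> {}"
  then obtain x where "x \<in> cylinder X w" and n: "length w = n" by blast
  then have "x \<in> X" "w = map (\<lambda>i. x (0 + int i)) [0..<n]"
    by (auto simp: cylinder_def intro!: nth_equalityI)
  with n show "w \<in> words X n" unfolding words_def by blast
qed

lemma language_iff_cylinder:
  assumes "shift_space X"
  shows "w \<in> language X \<longleftrightarrow> cylinder X w \<noteq> {}"
  by (simp add: language_def words_iff_cylinder[OF assms])

lemma words_eq_language: "words X n = {w \<in> language X. length w = n}"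
  by (auto simp: language_def words_def)

lemma finite_words: "finite (words (X :: (int \<Rightarrow> 'a::finite) set) n)"
  by (rule finite_subset[OF _ finite_lists_length_eq[of UNIV n]]) (auto simp: words_def)

lemma words_nonempty:
  assumes "X \<noteq> {}"
  shows "words X n \<noteq> {}"
proof -
  obtain x where "x \<in> X" using assms by blast
  then have "map (\<lambda>i. x (0 + int i)) [0..<n] \<in> words X n"
    unfolding words_def by (intro CollectI conjI bexI exI[of _ 0]) auto
  then show ?thesis by blast
qed

lemma card_words_pos: "X \<noteq> {} \<Longrightarrow> card (words (X :: (int \<Rightarrow> 'a::finite) set) n) > 0"
  by (simp add: card_gt_0_iff finite_words words_nonempty)

lemma cylinder_append_subset: "cylinder X (u @ v) \<subseteq> cylinder X u"
  by (auto simp: cylinder_def nth_append)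

lemma language_prefix:
  assumes "shift_space X" "u @ v \<in> language X"
  shows "u \<in> language X"
  using assms cylinder_append_subset[of X u v] by (auto simp: language_iff_cylinder)

lemma followers_subset_words:
  assumes "shift_space X"
  shows "followers X \<omega> r \<subseteq> words X r"
proof
  fix u assume "u \<in> followers X \<omega> r"
  then have u: "length u = r" "\<omega> @ u \<in> language X" by (auto simp: followers_def)
  then obtain x where "x \<in> cylinder X (\<omega> @ u)"
    using assms by (auto simp: language_iff_cylinder)
  then have x: "x \<in> X" "\<And>i. i < length \<omega> + length u \<Longrightarrow> x (int i) = (\<omega> @ u) ! i"
    by (auto simp: cylinder_def)
  have "(\<lambda>i. x (i + int (length \<omega>))) \<in> cylinder X u"
    using shift_space_translate[OF assms x(1)] x(2)[of "_ + length \<omega>"]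
    by (auto simp: cylinder_def nth_append)
  then show "u \<in> words X r" using u assms by (auto simp: words_iff_cylinder)
qed

lemma finite_followers:
  "shift_space (X :: (int \<Rightarrow> 'a::finite) set) \<Longrightarrow> finite (followers X \<omega> r)"
  using followers_subset_words finite_words finite_subset by metis

lemma followers_Nil: "followers X [] r = words X r"
  by (auto simp: followers_def words_eq_language)

lemma cylinder_disjoint:
  assumes "length u = length v" "u \<noteq> v"
  shows "cylinder X u \<inter> cylinder X v = {}"
  using assms by (auto simp: cylinder_def list_eq_iff_nth_eq)

text \<open>The next \<open>r\<close> coordinates of a point of the cylinder form the follower that
  selects its piece. The pieces are disjoint, so this is how additivity of a measure turns into a
  count of followers.\<close>

lemma cylinder_eq_UN_followers:
  assumes "shift_space X"
  shows "cylinder X \<omega> = (\<Union>u\<in>followers X \<omega> r. cylinder X (\<omega> @ u))"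
proof safe
  fix x assume x: "x \<in> cylinder X \<omega>"
  define u where "u = map (\<lambda>i. x (int (length \<omega> + i))) [0..<r]"
  have *: "x \<in> cylinder X (\<omega> @ u)"
    using x by (auto simp: cylinder_def nth_append u_def)
  then have "u \<in> followers X \<omega> r"
    using assms by (auto simp: followers_def language_iff_cylinder u_def)
  with * show "x \<in> (\<Union>u\<in>followers X \<omega> r. cylinder X (\<omega> @ u))" by blast
qed (use cylinder_append_subset in blast)

lemma words_with_prefix:
  assumes "length \<omega> \<le> N"
  shows "{w \<in> words X N. take (length \<omega>) w = \<omega>} = (@) \<omega> ` followers X \<omega> (N - length \<omega>)"
proof safe
  fix w assume w: "w \<in> words X N" and t: "take (length \<omega>) w = \<omega>"
  have "w = \<omega> @ drop (length \<omega>) w" using t by (metis append_take_drop_id)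
  with w show "w \<in> (@) \<omega> ` followers X \<omega> (N - length \<omega>)"
    by (intro image_eqI[of _ _ "drop (length \<omega>) w"]) (auto simp: followers_def words_eq_language)
qed (use assms in \<open>auto simp: followers_def words_eq_language\<close>)

lemma card_words_with_prefix:
  assumes "length \<omega> \<le> N"
  shows "card {w \<in> words X N. take (length \<omega>) w = \<omega>} = card (followers X \<omega> (N - length \<omega>))"
  unfolding words_with_prefix[OF assms] by (rule card_image) (simp add: inj_on_def)

text \<open>Group the words of length \<open>m + n\<close> by their prefix of length
  \<open>m\<close>. Bounding every summand from above and below later makes the word counts
  multiplicative up to a constant factor.\<close>

lemma card_words_add:
  fixes X :: "(int \<Rightarrow> 'a::finite) set"
  assumes "shift_space X"
  shows "card (words X (m + n)) = (\<Sum>\<omega>\<in>words X m. card (followers X \<omega> n))"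
proof -
  have "card (words X (m + n)) = (\<Sum>\<omega>\<in>words X m. card {w \<in> words X (m + n). take m w = \<omega>})"
  proof -
    have "take m ` words X (m + n) \<subseteq> words X m"
    proof safe
      fix w assume w: "w \<in> words X (m + n)"
      then have "take m w @ drop m w \<in> language X" by (simp add: words_eq_language)
      then have "take m w \<in> language X" using language_prefix[OF assms] by blast
      then show "take m w \<in> words X m" using w by (simp add: words_eq_language)
    qed
    then show ?thesis
      using sum.group[OF finite_words finite_words, of "take m" X "m + n" X m "\<lambda>_. 1::nat"]
      by simp
  qed
  also have "\<dots> = (\<Sum>\<omega>\<in>words X m. card (followers X \<omega> n))"
  proof (rule sum.cong)
    fix \<omega> assume "\<omega> \<in> words X m"
    then have "length \<omega> = m" by (simp add: words_def)
    then show "card {w \<in> words X (m + n). take m w = \<omega>} = card (followers X \<omega> n)"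
      using card_words_with_prefix[of \<omega> "m + n" X] by simp
  qed simp
  finally show ?thesis .
qed

section \<open>Topology, clopen sets and Borel sets\<close>

text \<open>A basic open set of the product restricts finitely many coordinates, all inside some
  window from \<open>-n\<close> to \<open>n\<close>. Conversely, fixing a window is an open
  condition because the alphabet is discrete.\<close>

lemma openin_shift_space_iff:
  "openin (subtopology fullshift_topology X) U \<longleftrightarrow>
    U \<subseteq> X \<and> (\<forall>x\<in>U. \<exists>n::nat. \<forall>y\<in>X. (\<forall>i. \<bar>i\<bar> \<le> int n \<longrightarrow> y i = x i) \<longrightarrow> y \<in> U)"
  (is "?L \<longleftrightarrow> ?R")
proof
  assume ?L
  then obtain V where V: "openin fullshift_topology V" "U = V \<inter> X"
    by (auto simp: openin_subtopology)
  show ?R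
  proof safe
    fix x assume "x \<in> U"
    then have "x \<in> V" using V by blast
    then obtain W where W: "finite {i. W i \<noteq> UNIV}" "x \<in> Pi\<^sub>E UNIV W" "Pi\<^sub>E UNIV W \<subseteq> V"
      using V(1) unfolding fullshift_topology_def openin_product_topology_alt by force
    obtain N where N: "\<And>i. W i \<noteq> UNIV \<Longrightarrow> \<bar>i\<bar> \<le> N"
    proof
      fix i assume "W i \<noteq> UNIV"
      then show "\<bar>i\<bar> \<le> Max (insert 0 (abs ` {i. W i \<noteq> UNIV}))"
        using W(1) by (intro Max_ge) auto
    qed
    show "\<exists>n::nat. \<forall>y\<in>X. (\<forall>i. \<bar>i\<bar> \<le> int n \<longrightarrow> y i = x i) \<longrightarrow> y \<in> U"
    proof (intro exI ballI impI)
      fix y assume y: "y \<in> X" "\<forall>i. \<bar>i\<bar> \<le> int (nat N) \<longrightarrow> y i = x i"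
      have "y i \<in> W i" for i
      proof (cases "W i = UNIV")
        case False
        then have "y i = x i" using N[OF False] y(2)[rule_format, of i] by linarith
        then show ?thesis using W(2) by auto
      qed simp
      then show "y \<in> U" using W(3) V(2) y(1) by auto
    qed
  qed (use V in auto)
next
  assume R: ?R
  define C where "C x n = Pi\<^sub>E UNIV (\<lambda>i. if \<bar>i\<bar> \<le> int n then {x i} else UNIV)"
    for x :: "int \<Rightarrow> 'a" and n :: nat
  have C_iff: "y \<in> C x n \<longleftrightarrow> (\<forall>i. \<bar>i\<bar> \<le> int n \<longrightarrow> y i = x i)" for x y n
    by (auto simp: C_def PiE_iff)
  have open_C: "openin fullshift_topology (C x n)" for x n
  proof -
    have "{i. \<bar>i\<bar> \<le> int n} = {- int n..int n}" by auto
    then have "finite {i. \<bar>i\<bar> \<le> int n}" by simp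
    then have "finite {i. (if \<bar>i\<bar> \<le> int n then {x i} else UNIV) \<noteq> UNIV}"
      by (rule rev_finite_subset) auto
    then show ?thesis unfolding C_def fullshift_topology_def
      by (intro product_topology_basis) auto
  qed
  have "\<exists>V. openin (subtopology fullshift_topology X) V \<and> x \<in> V \<and> V \<subseteq> U" if "x \<in> U" for x
  proof -
    from R that have "\<exists>n. \<forall>y\<in>X. y \<in> C x n \<longrightarrow> y \<in> U" unfolding C_iff by simp
    then obtain n where n: "\<forall>y\<in>X. y \<in> C x n \<longrightarrow> y \<in> U" ..
    have "openin (subtopology fullshift_topology X) (C x n \<inter> X)"
      using open_C openin_subtopology by blast
    moreover have "x \<in> X" using conjunct1[OF R] that by (rule subsetD)
    then have "x \<in> C x n \<inter> X" by (simp add: C_iff)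
    ultimately show ?thesis using n by (intro exI[of _ "C x n \<inter> X"]) blast
  qed
  then show ?L by (metis openin_subopen)
qed

lemma topspace_shift_space [simp]: "topspace (subtopology fullshift_topology X) = X"
  by (simp add: fullshift_topology_def)

text \<open>Sets of the form \<open>cylinder X w\<close> see only nonnegative coordinates and need
  not generate the Borel sets of a two-sided space. The clopen sets contain them, form an algebra
  and do generate.\<close>

definition clopens :: "(int \<Rightarrow> 'a) set \<Rightarrow> (int \<Rightarrow> 'a) set set" where
  "clopens X = {U. openin (subtopology fullshift_topology X) U \<and>
                   closedin (subtopology fullshift_topology X) U}"

text \<open>Exchanging \<open>x\<close> and \<open>y\<close> in the hypothesis makes it an
  equivalence, so the negation of \<open>P\<close> depends on the same window and the complement is
  open by the same argument.\<close>

lemma clopens_finite_coordinates: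
  fixes n :: nat
  assumes "\<And>x y. x \<in> X \<Longrightarrow> y \<in> X \<Longrightarrow> (\<And>i. \<bar>i\<bar> \<le> int n \<Longrightarrow> x i = y i) \<Longrightarrow> P x \<Longrightarrow> P y"
  shows "{x \<in> X. P x} \<in> clopens X"
proof -
  have open_if: "openin (subtopology fullshift_topology X) {x \<in> X. Q x}"
    if "\<And>x y. x \<in> X \<Longrightarrow> y \<in> X \<Longrightarrow> (\<And>i. \<bar>i\<bar> \<le> int n \<Longrightarrow> x i = y i) \<Longrightarrow> Q x \<Longrightarrow> Q y" for Q
    unfolding openin_shift_space_iff
  proof (intro conjI ballI exI[of _ n] impI)
    fix x y assume "x \<in> {x \<in> X. Q x}" "y \<in> X" "\<forall>i. \<bar>i\<bar> \<le> int n \<longrightarrow> y i = x i"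
    then show "y \<in> {x \<in> X. Q x}" using that[of x y] by simp
  qed blast
  have "X - {x \<in> X. P x} = {x \<in> X. \<not> P x}" by blast
  moreover have "openin (subtopology fullshift_topology X) {x \<in> X. \<not> P x}"
    by (rule open_if) (metis assms)
  moreover have "openin (subtopology fullshift_topology X) {x \<in> X. P x}"
    by (rule open_if) (rule assms)
  ultimately show ?thesis
    by (simp add: clopens_def closedin_def del: topspace_subtopology)
qed

lemma cylinder_in_clopens: "cylinder X w \<in> clopens X"
  unfolding cylinder_def
  by (rule clopens_finite_coordinates[where n = "length w"]) auto

lemma algebra_clopens: "algebra X (clopens X)"
proof -
  let ?T = "subtopology fullshift_topology X"
  have "openin ?T X" "closedin ?T X"
    using openin_topspace[of ?T] closedin_topspace[of ?T] unfolding topspace_shift_space by auto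
  then show ?thesis
    unfolding algebra_iff_Un clopens_def
    using openin_subset[of ?T] unfolding topspace_shift_space by auto
qed

text \<open>Every open \<open>U\<close> is a countable union of clopen sets: \<open>V n\<close>
  collects the points whose whole window neighbourhood of radius \<open>n\<close> stays in
  \<open>U\<close>, a condition on that window alone.\<close>

lemma sigma_sets_clopens: "sigma_sets X (clopens X) = borel_sets_of X"
  unfolding borel_sets_of_def
proof (rule sigma_sets_eqI)
  fix U assume "U \<in> {U. openin (subtopology fullshift_topology X) U}"
  then have U: "U \<subseteq> X"
      "\<And>x. x \<in> U \<Longrightarrow> \<exists>n::nat. \<forall>y\<in>X. (\<forall>i. \<bar>i\<bar> \<le> int n \<longrightarrow> y i = x i) \<longrightarrow> y \<in> U"
    by (auto simp: openin_shift_space_iff)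
  define V where
    "V n = {x \<in> X. \<forall>y\<in>X. (\<forall>i. \<bar>i\<bar> \<le> int n \<longrightarrow> y i = x i) \<longrightarrow> y \<in> U}" for n :: nat
  have "V n \<in> clopens X" for n
    unfolding V_def by (rule clopens_finite_coordinates[where n = n]) simp
  moreover have "U = (\<Union>n. V n)"
  proof
    show "U \<subseteq> (\<Union>n. V n)"
    proof
      fix x assume "x \<in> U"
      with U obtain n where "x \<in> V n" unfolding V_def by blast
      then show "x \<in> (\<Union>n. V n)" by blast
    qed
  qed (auto simp: V_def)
  ultimately show "U \<in> sigma_sets X (clopens X)"
    by (auto intro: sigma_sets.Union)
qed (auto simp: clopens_def)

section \<open>Compactness and extension to a Borel measure\<close>

lemma compact_shift_space:
  assumes "shift_space X"
  shows "compact_space (subtopology fullshift_topology X)"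
proof -
  have "compact_space (fullshift_topology :: (int \<Rightarrow> 'a) topology)"
    unfolding fullshift_topology_def
    by (simp add: compact_space_product_topology compact_space_discrete_topology)
  then show ?thesis
    using assms by (simp add: shift_space_def closedin_compact_space compact_space_subtopology)
qed

text \<open>By compactness, continuity at the empty set is automatic on clopen sets.\<close>

lemma extend_clopen_measure:
  fixes X :: "(int \<Rightarrow> 'a::finite) set" and m :: "(int \<Rightarrow> 'a) set \<Rightarrow> real"
  assumes X: "shift_space X"
    and nonneg: "\<And>A. m A \<ge> 0"
    and add: "\<And>A B. A \<inter> B = {} \<Longrightarrow> m (A \<union> B) = m A + m B"
    and "m X = 1"
  obtains \<mu> where "borel_prob_measure_on X \<mu>" "\<And>A. A \<in> clopens X \<Longrightarrow> measure \<mu> A = m A"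
proof -
  interpret algebra X "clopens X" by (rule algebra_clopens)
  have m_empty: "m {} = 0" using add[of "{}" "{}"] by simp
  have "\<exists>\<mu>. (\<forall>A\<in>clopens X. \<mu> A = ennreal (m A)) \<and>
      measure_space X (sigma_sets X (clopens X)) \<mu>"
  proof (rule caratheodory_empty_continuous)
    show "positive (clopens X) (\<lambda>A. ennreal (m A))"
      by (simp add: positive_def m_empty)
    show "additive (clopens X) (\<lambda>A. ennreal (m A))"
      by (simp add: additive_def add nonneg)
  next
    fix A :: "nat \<Rightarrow> (int \<Rightarrow> 'a) set"
    assume A: "range A \<subseteq> clopens X" "decseq A" "(\<Inter>i. A i) = {}"
    \<comment> \<open>Nonempty closed sets decreasing in a compact space would have a common point.
      Hence some \<open>A n\<close> is empty, and the values of \<open>m\<close> vanish from there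
      on.\<close>
    then obtain n where "A n = {}"
      using compact_space_imp_nest[OF compact_shift_space[OF X], of A]
      by (auto simp: clopens_def image_subset_iff)
    then have "A k = {}" if "k \<ge> n" for k using A(2) that by (auto simp: decseq_def)
    then show "(\<lambda>i. ennreal (m (A i))) \<longlonglongrightarrow> 0"
      by (intro tendsto_eventually eventually_sequentiallyI[of n]) (simp add: m_empty)
  qed simp
  then obtain \<mu> where \<mu>: "\<And>A. A \<in> clopens X \<Longrightarrow> \<mu> A = ennreal (m A)"
      "measure_space X (borel_sets_of X) \<mu>"
    unfolding sigma_sets_clopens by blast
  define M where "M = measure_of X (borel_sets_of X) \<mu>"
  have sub: "borel_sets_of X \<subseteq> Pow X"
    using sigma_sets_clopens space_closed sigma_sets_into_sp by blast
  have sets_M: "sets M = borel_sets_of X"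
    using \<mu>(2) sub by (simp add: M_def measure_space_def sigma_algebra.sigma_sets_eq)
  have space_M: "space M = X" using sub by (simp add: M_def)
  have em: "emeasure M A = ennreal (m A)" if "A \<in> clopens X" for A
  proof -
    have "A \<in> borel_sets_of X" using that sigma_sets_clopens by blast
    then have "emeasure M A = \<mu> A"
      using \<mu>(2) unfolding M_def measure_space_def
      by (intro emeasure_measure_of_sigma) auto
    then show ?thesis using \<mu>(1) that by simp
  qed
  have "prob_space M"
    by (rule prob_spaceI) (simp add: space_M em \<open>m X = 1\<close>)
  then have "borel_prob_measure_on X M"
    by (simp add: borel_prob_measure_on_def sets_M space_M)
  moreover have "measure M A = m A" if "A \<in> clopens X" for A
    using em[OF that] nonneg by (simp add: measure_def)
  ultimately show thesis by (rule that)
qed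

section \<open>Gibbs states force balance\<close>

lemma gibbs_imp_balanced:
  fixes X :: "(int \<Rightarrow> 'a::finite) set"
  assumes X: "shift_space X" "X \<noteq> {}" and "gibbs_state X \<mu>"
  shows "balanced X"
proof -
  from assms(3) obtain c1 c2 where \<mu>: "prob_space \<mu>" "space \<mu> = X" "sets \<mu> = borel_sets_of X"
    and c: "c1 > 0" "c2 > 0"
    and low: "\<And>\<omega>. \<omega> \<in> language X \<Longrightarrow>
        c1 \<le> measure \<mu> (cylinder X \<omega>) * 2 powr (real (length \<omega>) * entropy X)"
    and up: "\<And>\<omega>. \<omega> \<in> language X \<Longrightarrow>
        measure \<mu> (cylinder X \<omega>) * 2 powr (real (length \<omega>) * entropy X) \<le> c2"
    by (auto simp: gibbs_state_def borel_prob_measure_on_def)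
  \<comment> \<open>The scale \<open>g\<close> is exactly multiplicative, so the factor for the
    length of the prefix cancels and the final constant is independent of the prefix.\<close>
  define g where "g n = 2 powr (real n * entropy X)" for n
  note low = low[folded g_def] and up = up[folded g_def]
  interpret prob_space \<mu> by fact
  have g_pos: "g n > 0" for n by (simp add: g_def)
  have g_add: "g (m + n) = g m * g n" for m n
    by (simp add: g_def powr_add distrib_right)
  have cyl: "cylinder X w \<in> sets \<mu>" for w
    using cylinder_in_clopens sigma_sets_clopens \<mu>(3) by blast
  have split: "measure \<mu> (cylinder X \<omega>) =
      (\<Sum>u\<in>followers X \<omega> r. measure \<mu> (cylinder X (\<omega> @ u)))" for \<omega> r
    unfolding cylinder_eq_UN_followers[OF X(1), of \<omega> r]
  proof (rule finite_measure_finite_Union)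
    show "disjoint_family_on (\<lambda>u. cylinder X (\<omega> @ u)) (followers X \<omega> r)"
      unfolding disjoint_family_on_def
      by (intro ballI impI cylinder_disjoint) (auto simp: followers_def)
  qed (use cyl finite_followers[OF X(1)] in auto)
  have words_le: "c1 * real (card (words X r)) \<le> g r" for r
  proof -
    have "1 = measure \<mu> (cylinder X [])"
      using prob_space \<mu>(2) by (simp add: cylinder_def)
    also have "\<dots> = (\<Sum>u\<in>words X r. measure \<mu> (cylinder X u))"
      using split[of "[]" r] by (simp add: followers_Nil)
    also have "\<dots> \<ge> (\<Sum>u\<in>words X r. c1 / g r)"
      using low g_pos by (intro sum_mono) (auto simp: words_eq_language g_def divide_le_eq)
    finally show ?thesis using g_pos[of r] by (simp add: field_simps)
  qed
  \<comment> \<open>One factor \<open>c1\<close> comes from \<open>words_le\<close>; the quotient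
    \<open>c1 / c2\<close> comes from comparing the lower bound on the cylinder of the prefix with
    the upper bounds on its pieces.\<close>
  have "c1\<^sup>2 / c2 \<le> real (card (followers X \<omega> r)) / real (card (words X r))"
    if \<omega>: "\<omega> \<in> language X" for \<omega> r
  proof -
    let ?F = "real (card (followers X \<omega> r))" and ?n = "length \<omega>"
    have "c1 / g ?n \<le> measure \<mu> (cylinder X \<omega>)"
      using low[OF \<omega>] g_pos by (simp add: g_def divide_le_eq)
    also have "\<dots> \<le> (\<Sum>u\<in>followers X \<omega> r. c2 / g (?n + r))"
      unfolding split[of \<omega> r]
    proof (rule sum_mono)
      fix u assume "u \<in> followers X \<omega> r"
      then show "measure \<mu> (cylinder X (\<omega> @ u)) \<le> c2 / g (?n + r)"
        using up[of "\<omega> @ u"] g_pos by (auto simp: followers_def g_def le_divide_eq)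
    qed
    also have "\<dots> = ?F * c2 / (g ?n * g r)" by (simp add: g_add)
    finally have "c1 * g r \<le> ?F * c2"
      using g_pos[of ?n] g_pos[of r] by (simp add: field_simps)
    moreover have "c1 * (c1 * real (card (words X r))) \<le> c1 * g r"
      using words_le c by (intro mult_left_mono) auto
    ultimately have "c1\<^sup>2 * real (card (words X r)) \<le> ?F * c2"
      by (simp add: power2_eq_square)
    then show ?thesis
      using c card_words_pos[OF X(2), of r] by (simp add: field_simps)
  qed
  moreover have "c1\<^sup>2 / c2 > 0" using c by simp
  ultimately show ?thesis unfolding balanced_def by blast
qed

section \<open>Two limit tools: almost additive sequences and cluster points\<close>

text \<open>Evaluate \<open>a (n * k)\<close> both as \<open>n\<close> blocks of length
  \<open>k\<close> and as \<open>k\<close> blocks of length \<open>n\<close>. Comparing the two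
  bounds the difference of \<open>real n * a k\<close> and \<open>real k * a n\<close> linearly in
  \<open>n + k\<close>. Division by \<open>n * k\<close> yields the Cauchy property, which gives
  \<open>lim\<close> its meaning.\<close>

lemma almost_additive_limit:
  fixes a :: "nat \<Rightarrow> real"
  assumes a: "\<And>m n. \<bar>a (m + n) - a m - a n\<bar> \<le> C"
  shows "\<bar>a n - real n * lim (\<lambda>n. a n / real n)\<bar> \<le> C"
proof -
  have C: "C \<ge> 0" using a[of 0 0] by linarith
  \<comment> \<open>The extra \<open>C\<close> pays for \<open>k = 0\<close>, where the hypothesis
    bounds \<open>a 0\<close> only by \<open>C\<close> in absolute value.\<close>
  have mult: "\<bar>a (k * n) - real k * a n\<bar> \<le> real (k + 1) * C" for k n
  proof (induction k)
    case 0
    then show ?case using a[of 0 0] by simp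
  next
    case (Suc k)
    have "a (Suc k * n) - real (Suc k) * a n
        = (a (n + k * n) - a n - a (k * n)) + (a (k * n) - real k * a n)"
      by (simp add: algebra_simps)
    also have "\<bar>\<dots>\<bar> \<le> C + real (k + 1) * C"
      using a[of n "k * n"] Suc.IH by linarith
    finally show ?case by (simp add: algebra_simps)
  qed
  have diff: "\<bar>real n * a k - real k * a n\<bar> \<le> real (n + k + 2) * C" for n k
    using mult[of n k] mult[of k n] by (simp add: algebra_simps)
  have diff': "\<bar>a k / real k - a n / real n\<bar> \<le> C / real n + C / real k + 2 * C / (real n * real k)"
    if "n > 0" "k > 0" for n k
  proof -
    have "a k / real k - a n / real n = (real n * a k - real k * a n) / (real n * real k)"
      using that by (simp add: field_simps)
    also have "\<bar>\<dots>\<bar> \<le> real (n + k + 2) * C / (real n * real k)"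
      using diff[of n k] that by (simp add: divide_right_mono)
    also have "\<dots> = C / real n + C / real k + 2 * C / (real n * real k)"
      using that by (simp add: field_simps)
    finally show ?thesis .
  qed
  have "Cauchy (\<lambda>n. a n / real n)"
  proof (rule CauchyI)
    fix e :: real assume "e > 0"
    obtain M where M: "real M > 4 * C / e" using reals_Archimedean2 by blast
    have "norm (a m / real m - a n / real n) < e" if "m \<ge> M + 1" "n \<ge> M + 1" for m n
    proof -
      have "real n > 0" "real m \<ge> 1" using that by auto
      have *: "C / real k < e / 4" if "k \<ge> M + 1" for k
      proof -
        have "4 * C / e < real k" using M that by linarith
        then show ?thesis using \<open>e > 0\<close> that by (simp add: field_simps)
      qed
      have "2 * C / (real n * real m) \<le> 2 * C / (real n * 1)"
        using \<open>real n > 0\<close> \<open>real m \<ge> 1\<close> C by (intro divide_left_mono mult_left_mono) auto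
      also have "\<dots> = 2 * (C / real n)" by simp
      finally have "\<bar>a m / real m - a n / real n\<bar> < e"
        using diff'[of n m] that *[of m] *[of n] by linarith
      then show ?thesis by simp
    qed
    then show "\<exists>M. \<forall>m\<ge>M. \<forall>n\<ge>M. norm (a m / real m - a n / real n) < e" by blast
  qed
  then have L: "(\<lambda>n. a n / real n) \<longlonglongrightarrow> lim (\<lambda>n. a n / real n)" (is "_ \<longlonglongrightarrow> ?h")
    by (simp add: Cauchy_convergent_iff convergent_LIMSEQ_iff)
  \<comment> \<open>Fix \<open>n\<close> and let \<open>k\<close> grow: the error
    \<open>(n + k + 2) * C / k\<close> tends to exactly \<open>C\<close>.\<close>
  have "(\<lambda>k. \<bar>real n * (a k / real k) - a n\<bar>) \<longlonglongrightarrow> \<bar>real n * ?h - a n\<bar>"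
    by (intro tendsto_intros L)
  moreover have "(\<lambda>k. C * (1 + real (n + 2) / real k)) \<longlonglongrightarrow> C * (1 + 0)"
    by (intro tendsto_intros lim_const_over_n)
  moreover have "\<forall>\<^sub>F k in sequentially.
      \<bar>real n * (a k / real k) - a n\<bar> \<le> C * (1 + real (n + 2) / real k)"
  proof (rule eventually_mono[OF eventually_gt_at_top[of 0]])
    fix k :: nat assume k: "k > 0"
    have "real n * (a k / real k) - a n = (real n * a k - real k * a n) / real k"
      using k by (simp add: field_simps)
    also have "\<bar>\<dots>\<bar> \<le> real (n + k + 2) * C / real k"
      using diff[of n k] k by (simp add: divide_right_mono)
    also have "\<dots> = C * (1 + real (n + 2) / real k)"
      using k by (simp add: field_simps)
    finally show "\<bar>real n * (a k / real k) - a n\<bar> \<le> C * (1 + real (n + 2) / real k)" .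
  qed
  ultimately have "\<bar>real n * ?h - a n\<bar> \<le> C * (1 + 0)"
    by (intro tendsto_le[OF sequentially_bot]) auto
  then show ?thesis by (simp add: abs_minus_commute)
qed

text \<open>The index type will be all sets of sequences, where a convergent subsequence need not
  exist; Tychonoff still gives convergence along a filter. \<open>G \<le> sequentially\<close>
  preserves whatever holds for large \<open>n\<close>, and \<open>G \<noteq> bot\<close> makes
  limits unique.\<close>

lemma unit_interval_functions_cluster:
  fixes f :: "nat \<Rightarrow> 'b \<Rightarrow> real"
  assumes "\<And>n A. f n A \<in> {0..1}"
  obtains G m where "G \<noteq> bot" "G \<le> sequentially" "\<And>A. ((\<lambda>n. f n A) \<longlongrightarrow> m A) G"
proof -
  have "compactin (product_topology (\<lambda>_. euclidean) UNIV) (Pi\<^sub>E UNIV (\<lambda>_::'b. {0..1::real}))"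
    unfolding compactin_PiE by simp
  then have comp: "compact (Pi\<^sub>E UNIV (\<lambda>_::'b. {0..1::real}))"
    by (simp add: euclidean_product_topology)
  have "\<forall>\<^sub>F g in filtermap f sequentially. g \<in> Pi\<^sub>E UNIV (\<lambda>_::'b. {0..1::real})"
    using assms by (simp add: eventually_filtermap PiE_iff)
  then obtain m where m: "inf (nhds m) (filtermap f sequentially) \<noteq> bot"
    using comp unfolding compact_filter
    by (metis filtermap_bot_iff sequentially_bot)
  \<comment> \<open>Pulling neighbourhoods of \<open>m\<close> back along \<open>f\<close> forces
    convergence; the filter is proper because \<open>m\<close> is a cluster point of the
    sequence.\<close>
  define G where "G = inf (filtercomap f (nhds m)) sequentially"
  have "G \<noteq> bot"
  proof
    assume "G = bot"
    then obtain P Q where PQ: "eventually P (nhds m)" "eventually Q sequentially"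
      "\<And>n. P (f n) \<Longrightarrow> \<not> Q n"
      unfolding G_def trivial_limit_def eventually_inf eventually_filtercomap by blast
    then have "eventually (\<lambda>g. \<not> P g) (filtermap f sequentially)"
      unfolding eventually_filtermap by (metis (mono_tags, lifting) eventually_mono)
    with PQ(1) have "eventually (\<lambda>_. False) (inf (nhds m) (filtermap f sequentially))"
      unfolding eventually_inf by blast
    with m show False by (simp add: trivial_limit_def)
  qed
  moreover have "G \<le> sequentially" by (simp add: G_def)
  moreover have "(f \<longlongrightarrow> m) G"
    unfolding filterlim_def filtermap_le_iff_le_filtercomap by (simp add: G_def)
  then have "((\<lambda>n. f n A) \<longlongrightarrow> m A) G" for A
    using continuous_on_tendsto_compose[OF continuous_on_product_coordinates[of A], of f m G]
    by simp
  ultimately show thesis by (rule that)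
qed

section \<open>Balance yields a Gibbs state\<close>

lemma balanced_imp_gibbs:
  fixes X :: "(int \<Rightarrow> 'a::finite) set"
  assumes X: "shift_space X" "X \<noteq> {}" and "balanced X"
  shows "\<exists>\<mu>. gibbs_state X \<mu>"
proof -
  obtain B where B: "B > 0"
    and bal: "\<And>\<omega> r. \<omega> \<in> language X \<Longrightarrow>
      B \<le> real (card (followers X \<omega> r)) / real (card (words X r))"
    using assms(3) by (auto simp: balanced_def)
  define b where "b n = real (card (words X n))" for n
  have b_pos: "b n > 0" for n using card_words_pos[OF X(2)] by (simp add: b_def)
  have F_le: "real (card (followers X \<omega> r)) \<le> b r" for \<omega> r
    unfolding b_def using card_mono[OF finite_words followers_subset_words[OF X(1)]] by simp
  have F_ge: "B * b r \<le> real (card (followers X \<omega> r))" if "\<omega> \<in> language X" for \<omega> r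
    using bal[OF that, of r] b_pos[of r] by (simp add: b_def field_simps)
  have b_sum: "b (m + n) = (\<Sum>\<omega>\<in>words X m. real (card (followers X \<omega> n)))" for m n
    by (simp add: b_def card_words_add[OF X(1)])
  have b_le: "b (m + n) \<le> b m * b n" for m n
    using sum_mono[of "words X m" "\<lambda>\<omega>. real (card (followers X \<omega> n))" "\<lambda>_. b n"] F_le
    by (simp add: b_sum) (simp add: b_def)
  have b_ge: "B * (b m * b n) \<le> b (m + n)" for m n
    using sum_mono[of "words X m" "\<lambda>_. B * b n" "\<lambda>\<omega>. real (card (followers X \<omega> n))"] F_ge
    by (simp add: b_sum words_eq_language) (simp add: b_def words_eq_language mult_ac)
  define a where "a n = log 2 (b n)" for n
  define C where "C = - log 2 B"
  have "\<bar>a (m + n) - a m - a n\<bar> \<le> C" for m n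
  proof -
    have "a (m + n) \<le> log 2 (b m * b n)"
      unfolding a_def using b_le b_pos by simp
    then have 1: "a (m + n) \<le> a m + a n"
      using b_pos[of m] b_pos[of n] by (simp add: a_def log_mult)
    have "log 2 (B * (b m * b n)) \<le> a (m + n)"
      unfolding a_def using b_ge b_pos B by simp
    then have 2: "log 2 B + (a m + a n) \<le> a (m + n)"
      using b_pos[of m] b_pos[of n] B by (simp add: a_def log_mult)
    \<comment> \<open>Together the two inequalities force \<open>log 2 B \<le> 0\<close>, so
      \<open>C\<close> is nonnegative and bounds the difference from above as well.\<close>
    from 1 2 show ?thesis by (simp add: C_def)
  qed
  from almost_additive_limit[of a, OF this]
  have ent: "\<bar>a n - real n * entropy X\<bar> \<le> C" for n
    by (simp add: entropy_def a_def b_def)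
  \<comment> \<open>Up to a factor between \<open>B\<close> and 1, this quotient will be the mass of
    a cylinder of length \<open>n\<close>. Replacing \<open>a r\<close> and \<open>a (n + r)\<close>
    by multiples of the entropy costs \<open>C\<close> each, hence \<open>2 * C\<close>.\<close>
  have ratio: "2 powr (- 2 * C) \<le> b r / b (n + r) * 2 powr (real n * entropy X)"
    "b r / b (n + r) * 2 powr (real n * entropy X) \<le> 2 powr (2 * C)" for n r
  proof -
    have b_eq: "b k = 2 powr (a k)" for k using b_pos by (simp add: a_def)
    have "b r / b (n + r) * 2 powr (real n * entropy X)
        = 2 powr (a r - a (n + r) + real n * entropy X)"
      by (simp add: b_eq powr_diff powr_add)
    moreover have "\<bar>a r - a (n + r) + real n * entropy X\<bar> \<le> 2 * C"
      using ent[of r] ent[of "n + r"] by (simp add: algebra_simps)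
    ultimately show "2 powr (- 2 * C) \<le> b r / b (n + r) * 2 powr (real n * entropy X)"
      "b r / b (n + r) * 2 powr (real n * entropy X) \<le> 2 powr (2 * C)"
      by (simp_all add: abs_le_iff)
  qed
  \<comment> \<open>\<open>f N\<close> is the uniform measure on one representative in \<open>X\<close> of each word of length \<open>N\<close>.\<close>
  define x where "x w = (SOME y. y \<in> cylinder X w)" for w
  have x: "x w \<in> cylinder X w" if "w \<in> words X n" for w n
    using that unfolding x_def words_iff_cylinder[OF X(1)] by (simp add: some_in_eq)
  define f where "f N A = real (card {w \<in> words X N. x w \<in> A}) / b N" for N A
  have f01: "f N A \<in> {0..1}" for N A
    using b_pos[of N] card_mono[OF finite_words, of "{w \<in> words X N. x w \<in> A}" X N]
    by (auto simp: f_def b_def)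
  obtain G m where G: "G \<noteq> bot" "G \<le> sequentially" and
    lim: "\<And>A. ((\<lambda>N. f N A) \<longlongrightarrow> m A) G"
    using unit_interval_functions_cluster[of f, OF f01] by blast
  have "m A \<ge> 0" for A
    using b_pos by (intro tendsto_lowerbound[OF lim _ G(1)]) (simp add: f_def less_imp_le)
  moreover have "m (A \<union> D) = m A + m D" if "A \<inter> D = {}" for A D
  proof -
    have "f N (A \<union> D) = f N A + f N D" for N
    proof -
      have "{w \<in> words X N. x w \<in> A \<union> D} = {w \<in> words X N. x w \<in> A} \<union> {w \<in> words X N. x w \<in> D}"
        by auto
      then have "card {w \<in> words X N. x w \<in> A \<union> D}
          = card {w \<in> words X N. x w \<in> A} + card {w \<in> words X N. x w \<in> D}"
        using that finite_words[of X N] by (simp add: card_Un_disjoint disjoint_iff)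
      then show ?thesis by (simp add: f_def add_divide_distrib)
    qed
    then have "((\<lambda>N. f N (A \<union> D)) \<longlongrightarrow> m A + m D) G"
      by (simp add: tendsto_add lim)
    then show ?thesis using lim tendsto_unique[OF G(1)] by blast
  qed
  moreover have "m X = 1"
  proof -
    have "{w \<in> words X N. x w \<in> X} = words X N" for N
      using x by (auto simp: cylinder_def)
    then have "f N X = 1" for N using b_pos[of N] by (simp add: f_def b_def)
    then show ?thesis using lim[of X] G(1) by (simp add: tendsto_const_iff)
  qed
  ultimately obtain \<mu> where \<mu>: "borel_prob_measure_on X \<mu>"
      "\<And>A. A \<in> clopens X \<Longrightarrow> measure \<mu> A = m A"
    using extend_clopen_measure[OF X(1)] by blast
  have "B * 2 powr (- 2 * C) \<le> measure \<mu> (cylinder X \<omega>) * 2 powr (real (length \<omega>) * entropy X) \<and>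
      measure \<mu> (cylinder X \<omega>) * 2 powr (real (length \<omega>) * entropy X) \<le> 2 powr (2 * C)"
    if \<omega>: "\<omega> \<in> language X" for \<omega>
  proof -
    let ?n = "length \<omega>" and ?g = "2 powr (real (length \<omega>) * entropy X)"
    have f_cyl: "f N (cylinder X \<omega>) = real (card (followers X \<omega> (N - ?n))) / b N"
      if "N \<ge> ?n" for N
    proof -
      \<comment> \<open>The representative carries \<open>w\<close> from coordinate 0 on, so for
        \<open>N \<ge> ?n\<close> the word alone decides membership, whichever point was
        chosen.\<close>
      have "x w \<in> cylinder X \<omega> \<longleftrightarrow> take ?n w = \<omega>" if "w \<in> words X N" for w
      proof -
        have "length w = N" using that by (simp add: words_def)
        then show ?thesis
          using x[OF that] \<open>N \<ge> ?n\<close> by (auto simp: cylinder_def list_eq_iff_nth_eq)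
      qed
      then have "{w \<in> words X N. x w \<in> cylinder X \<omega>} = {w \<in> words X N. take ?n w = \<omega>}" by blast
      then show ?thesis by (simp add: f_def card_words_with_prefix[OF that])
    qed
    have bounds: "B * 2 powr (- 2 * C) \<le> f N (cylinder X \<omega>) * ?g \<and>
        f N (cylinder X \<omega>) * ?g \<le> 2 powr (2 * C)" if N: "N \<ge> ?n" for N
    proof -
      define r where "r = N - ?n"
      have Nr: "N = ?n + r" using N by (simp add: r_def)
      have f_eq: "f N (cylinder X \<omega>) = real (card (followers X \<omega> r)) / b (?n + r)"
        using f_cyl[OF N] by (simp add: Nr)
      have "B * 2 powr (- 2 * C) \<le> B * (b r / b (?n + r) * ?g)"
        using B ratio(1) by (intro mult_left_mono) auto
      also have "\<dots> = (B * b r) / b (?n + r) * ?g" by simp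
      also have "\<dots> \<le> f N (cylinder X \<omega>) * ?g"
        unfolding f_eq using F_ge[OF \<omega>, of r] b_pos[of "?n + r"]
        by (intro mult_right_mono divide_right_mono) auto
      finally have 1: "B * 2 powr (- 2 * C) \<le> f N (cylinder X \<omega>) * ?g" .
      have "f N (cylinder X \<omega>) * ?g \<le> b r / b (?n + r) * ?g"
        unfolding f_eq using F_le[of \<omega> r] b_pos[of "?n + r"]
        by (intro mult_right_mono divide_right_mono) auto
      also have "\<dots> \<le> 2 powr (2 * C)" by (rule ratio(2))
      finally show ?thesis using 1 by blast
    qed
    \<comment> \<open>The bounds start at \<open>N = ?n\<close>, a threshold depending on the word,
      but their constants do not; \<open>G\<close> ignores any initial segment, so the limit
      inherits the same constants for all words.\<close>
    have ev: "\<forall>\<^sub>F N in G. N \<ge> ?n"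
      using G(2) eventually_ge_at_top[of ?n] by (rule filter_leD)
    have L: "((\<lambda>N. f N (cylinder X \<omega>) * ?g) \<longlongrightarrow> m (cylinder X \<omega>) * ?g) G"
      by (intro tendsto_intros lim)
    have "B * 2 powr (- 2 * C) \<le> m (cylinder X \<omega>) * ?g"
      using bounds by (intro tendsto_lowerbound[OF L _ G(1)] eventually_mono[OF ev]) blast
    moreover have "m (cylinder X \<omega>) * ?g \<le> 2 powr (2 * C)"
      using bounds by (intro tendsto_upperbound[OF L _ G(1)] eventually_mono[OF ev]) blast
    ultimately show ?thesis by (simp add: \<mu>(2) cylinder_in_clopens)
  qed
  moreover have "B * 2 powr (- 2 * C) > 0" "2 powr (2 * C) > (0::real)" using B by simp_all
  ultimately have "gibbs_state X \<mu>"
    unfolding gibbs_state_def using \<mu>(1) by blast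
  then show ?thesis by blast
qed

theorem theorem3p14:
  fixes X :: "(int \<Rightarrow> 'a::finite) set"
  assumes "shift_space X" and "X \<noteq> {}"
  shows "(\<exists>\<mu>. gibbs_state X \<mu>) \<longleftrightarrow> balanced X"
  using gibbs_imp_balanced[OF assms] balanced_imp_gibbs[OF assms] by blast

end
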